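(* Let $\mathcal H$ be a real Hilbert space, let $A_1,A_2:\mathcal H\to2^{\mathcal H}$ be maximal monotone, and let $\lambda_1,\lambda_2>0$ with $\lambda_1+\lambda_2=1$. The following hold. (i) Let $A:=(\lambda_1J_{A_1}+\lambda_2J_{A_2})^{-1}-\operatorname{Id}$. Then $$\operatorname{Fix}J_A=\big(\lambda_1\,{}^1\!A_1+\lambda_2\,{}^1\!A_2\big)^{-1}(0)=\{z\in\mathcal H: z=J_A(z)=\lambda_1J_{A_1}(z)+\lambda_2J_{A_2}(z)\}.$$ (ii) Let $E:=\big(\tfrac{A_1}{\lambda_2}+{}^1(\tfrac{A_2}{\lambda_1})\big)^{-1}(0)$ and $F:=\big({}^1(\tfrac{A_1}{\lambda_2})+\tfrac{A_2}{\lambda_1}\big)^{-1}(0)$. Then $E=\operatorname{Fix}J_{A_1/\lambda_2}J_{A_2/\lambda_1}=J_{A_1/\lambda_2}(F)$. (iii) $F=\operatorname{Fix}J_{A_2/\lambda_1}J_{A_1/\lambda_2}=J_{A_2/\lambda_1}(E)$. (iv) Let $S:=\big((\operatorname{Id}-R)+(\tfrac{A_1}{\lambda_2}\times\tfrac{A_2}{\lambda_1})\big)^{-1}(0,0)$. Then $$S=\{(x,y): x=J_{A_1/\lambda_2}y,\ y=J_{A_2/\lambda_1}x\}=\operatorname{Fix}\big(J_{A_1/\lambda_2\times A_2/\lambda_1}\circ R\big)=(E\times F)\cap\operatorname{gr}J_{A_2/\lambda_1}.$$ (v) Let $S^*:=\big((\operatorname{Id}-R)^{-1}+(\tfrac{A_1}{\lambda_2}\times\tfrac{A_2}{\lambda_1})^{-1}\big)^{-1}(0,0)$.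 Then $S^*$ is at most a singleton, with $$S^*=\{(u^*,v^* ): u^*=J_{(A_1/\lambda_2)^{-1}+\widetilde{A_2/\lambda_1}}(0),\ v^*=J_{\widetilde{A_1/\lambda_2}+(A_2/\lambda_1)^{-1}}(0)\},$$ and moreover $u^*=-v^*$. ($S^*$ may be empty, which is equivalent to the resolvents defining $u^*$ and $v^*$ not being defined at $0$.) (vi) $S^*=(R-\operatorname{Id})(S)$. Consequently, $y-x=u^*$ for every $(x,y)\in S$. In (vii)–(x) assume that $S^*\neq\varnothing$ and write $S^*=\{(u^*,v^* )\}$. (vii) $E=(A_1/\lambda_2)^{-1}(u^* )\cap\big({}^1(A_2/\lambda_1)\big)^{-1}(v^* )$ and $F=\big({}^1(A_1/\lambda_2)\big)^{-1}(u^* )\cap(A_2/\lambda_1)^{-1}(v^* )$. (viii) $J_{A_2/\lambda_1}|_E:E\to F: x\mapsto x+u^*$ is a bijection with inverse $J_{A_1/\lambda_2}|_F:F\to E: y\mapsto y+v^*$. (ix) $S=(E\times F)\cap(R-\operatorname{Id})^{-1}(u^*,v^* )=\big(\tfrac{A_1}{\lambda_2}\times\tfrac{A_2}{\lambda_1}\big)^{-1}(u^*,v^* )\cap(R-\operatorname{Id})^{-1}(u^*,v^* )$. (x) $\operatorname{Fix}J_A=\big(\tfrac{{}^1\!A_1}{\lambda_2}\big)^{-1}(u^* )\cap\big(\tfrac{{}^1\!A_2}{\lambda_1}\big)^{-1}(v^* )$. (xi) The sets $\operatorname{Fix}J_A,E,F,S$ are closed and convex.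
   Context: For a set-valued operator $B$ on a Hilbert space: $J_B:=(B+\operatorname{Id})^{-1}$ is the resolvent (single-valued with full domain if $B$ is maximal monotone; then regarded as a map); for $\gamma>0$ the Yosida approximation is ${}^{\gamma}\!B:=(\operatorname{Id}-J_{\gamma B})/\gamma=(\gamma\operatorname{Id}+B^{-1})^{-1}$, so ${}^1\!B=\operatorname{Id}-J_B$; $\widetilde B:=(-\operatorname{Id})\circ B^{-1}\circ(-\operatorname{Id})$; $B/\lambda$ is $x\mapsto\{u/\lambda:u\in Bx\}$. $B^{-1}$ is the set-valued inverse, $B^{-1}(u)=\{x:u\in Bx\}$; $\operatorname{gr}$ denotes the graph. $R:\mathcal H\times\mathcal H\to\mathcal H\times\mathcal H$ is $R(x,y)=(y,x)$, and $(B_1\times B_2)(x,y)=B_1x\times B_2y$. $\operatorname{Fix}T=\{x:Tx=x\}$. For monotone $B$ not necessarily maximal, $w=J_B(0)$ means $0\in w+Bw$ (such $w$ is unique if it exists). *)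

theory Defs
  imports "HOL-Analysis.Analysis"
begin

text \<open>A set-valued operator from \<open>'a\<close> to \<open>'b\<close> is a function of type \<open>'a \<Rightarrow> 'b set\<close>;
  an everywhere defined single-valued one is \<open>op_single f\<close> for a map \<open>f\<close>.\<close>

definition op_single :: "('a \<Rightarrow> 'b) \<Rightarrow> 'a \<Rightarrow> 'b set"
  where "op_single f x = {f x}"

abbreviation op_Id :: "'a \<Rightarrow> 'a set"
  where "op_Id \<equiv> op_single (\<lambda>x. x)"

definition op_graph :: "('a \<Rightarrow> 'b set) \<Rightarrow> ('a \<times> 'b) set"
  where "op_graph B = {(x, u). u \<in> B x}"

definition op_inverse :: "('a \<Rightarrow> 'b set) \<Rightarrow> 'b \<Rightarrow> 'a set"
  where "op_inverse B u = {x. u \<in> B x}"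

definition op_add :: "('a \<Rightarrow> 'b::plus set) \<Rightarrow> ('a \<Rightarrow> 'b set) \<Rightarrow> 'a \<Rightarrow> 'b set"
  where "op_add B C x = {u + v | u v. u \<in> B x \<and> v \<in> C x}"

definition op_diff :: "('a \<Rightarrow> 'b::minus set) \<Rightarrow> ('a \<Rightarrow> 'b set) \<Rightarrow> 'a \<Rightarrow> 'b set"
  where "op_diff B C x = {u - v | u v. u \<in> B x \<and> v \<in> C x}"

definition op_scale :: "real \<Rightarrow> ('a \<Rightarrow> 'b::real_vector set) \<Rightarrow> 'a \<Rightarrow> 'b set"
  where "op_scale c B x = {c *\<^sub>R u | u. u \<in> B x}"

definition op_divide :: "('a \<Rightarrow> 'b::real_vector set) \<Rightarrow> real \<Rightarrow> 'a \<Rightarrow> 'b set"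
  where "op_divide B c x = {u /\<^sub>R c | u. u \<in> B x}"

definition op_comp :: "('b \<Rightarrow> 'c set) \<Rightarrow> ('a \<Rightarrow> 'b set) \<Rightarrow> 'a \<Rightarrow> 'c set"
  where "op_comp B C x = (\<Union>y\<in>C x. B y)"

definition op_times :: "('a \<Rightarrow> 'c set) \<Rightarrow> ('b \<Rightarrow> 'd set) \<Rightarrow> 'a \<times> 'b \<Rightarrow> ('c \<times> 'd) set"
  where "op_times B C p = B (fst p) \<times> C (snd p)"

definition op_tilde :: "('a::uminus \<Rightarrow> 'b::uminus set) \<Rightarrow> 'b \<Rightarrow> 'a set"
  where "op_tilde B = op_comp (op_single uminus) (op_comp (op_inverse B) (op_single uminus))"

definition op_monotone :: "('a::real_inner \<Rightarrow> 'a set) \<Rightarrow> bool"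
  where "op_monotone B \<longleftrightarrow>
    (\<forall>(x, u)\<in>op_graph B. \<forall>(y, v)\<in>op_graph B. 0 \<le> inner (x - y) (u - v))"

definition op_maximal_monotone :: "('a::real_inner \<Rightarrow> 'a set) \<Rightarrow> bool"
  where "op_maximal_monotone B \<longleftrightarrow>
    op_monotone B \<and> (\<forall>C. op_monotone C \<and> op_graph B \<subseteq> op_graph C \<longrightarrow> op_graph C = op_graph B)"

definition op_resolvent :: "('a::real_vector \<Rightarrow> 'a set) \<Rightarrow> 'a \<Rightarrow> 'a set"
  where "op_resolvent B = op_inverse (op_add B op_Id)"

text \<open>The resolvent regarded as a map. It is meaningful at \<open>x\<close> only if \<open>op_resolvent B x\<close> is a
  singleton, which holds for every \<open>x\<close> if \<open>B\<close> is maximal monotone (on a Hilbert space). For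
  operators that may fail to be maximal, use \<open>w \<in> op_resolvent B x\<close> instead.\<close>

definition resolvent :: "('a::real_vector \<Rightarrow> 'a set) \<Rightarrow> 'a \<Rightarrow> 'a"
  where "resolvent B x = (THE y. y \<in> op_resolvent B x)"

definition yosida :: "real \<Rightarrow> ('a::real_vector \<Rightarrow> 'a set) \<Rightarrow> 'a \<Rightarrow> 'a set"
  where "yosida c B = op_divide (op_diff op_Id (op_resolvent (op_scale c B))) c"

lemma yosida_eq:
  assumes "c > 0"
  shows "yosida c B = op_inverse (op_add (op_scale c op_Id) (op_inverse B))"
proof (intro ext set_eqI)
  fix x u
  have "u \<in> yosida c B x \<longleftrightarrow> (\<exists>y w. w \<in> B y \<and> x = c *\<^sub>R w + y \<and> u = (x - y) /\<^sub>R c)"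
    by (auto simp: yosida_def op_divide_def op_diff_def op_single_def op_resolvent_def
        op_inverse_def op_add_def op_scale_def)
  also have "\<dots> \<longleftrightarrow> (\<exists>y. u \<in> B y \<and> x = c *\<^sub>R u + y)"
  proof
    assume "\<exists>y. u \<in> B y \<and> x = c *\<^sub>R u + y"
    then obtain y where "u \<in> B y" "x = c *\<^sub>R u + y" by blast
    then show "\<exists>y w. w \<in> B y \<and> x = c *\<^sub>R w + y \<and> u = (x - y) /\<^sub>R c"
      using assms by (intro exI[of _ y] exI[of _ u]) simp
  qed (use assms in auto)
  also have "\<dots> \<longleftrightarrow> u \<in> op_inverse (op_add (op_scale c op_Id) (op_inverse B)) x"
    by (auto simp: op_single_def op_inverse_def op_add_def op_scale_def)
  finally show "u \<in> yosida c B x \<longleftrightarrow>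
      u \<in> op_inverse (op_add (op_scale c op_Id) (op_inverse B)) x" .
qed

lemma zero_in_resolvent_iff:
  "w \<in> op_resolvent B 0 \<longleftrightarrow> (\<exists>b\<in>B w. 0 = w + b)"
  by (auto simp: op_resolvent_def op_inverse_def op_add_def op_single_def add.commute)

definition Fix :: "('a \<Rightarrow> 'a) \<Rightarrow> 'a set"
  where "Fix T = {x. T x = x}"

end

theory Submission imports Defs begin

text \<open>
  Put \<open>B1 = A1 / l2\<close> and \<open>B2 = A2 / l1\<close>. The whole theorem is about the \<^emph>\<open>cycles\<close>, the pairs
  \<open>(x, y)\<close> with \<open>y - x \<in> B1 x\<close> and \<open>x - y \<in> B2 y\<close>, that is, \<open>x\<close> is the resolvent of \<open>B1\<close> at \<open>y\<close>
  and \<open>y\<close> is the resolvent of \<open>B2\<close> at \<open>x\<close>. Solving the inclusions that define them shows that \<open>S\<close> is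
  the set \<open>K\<close> of cycles, that \<open>E\<close> and \<open>F\<close> are its two projections, that \<open>S'\<close> is its image under
  \<open>(x, y) \<mapsto> (y - x, x - y)\<close>, and that the fixed points of the averaged resolvent are the points
  \<open>l1 x + l2 y\<close> with \<open>(x, y) \<in> K\<close>. For the last claim, if \<open>l1 a + l2 b = 0\<close> with
  \<open>a \<in> A1 (z - a)\<close> and \<open>b \<in> A2 (z - b)\<close>, then \<open>x = z - a\<close> and \<open>y = z - b\<close> satisfy
  \<open>y - x = a - b = a / l2\<close> because \<open>l1 + l2 = 1\<close>.

  Adding the two monotonicity inequalities for cycles \<open>(x, y)\<close> and \<open>(x', y')\<close> yields
  \<open>- norm ((y - x) - (y' - x'))^2 \<ge> 0\<close>, so all cycles have the same gap \<open>u = y - x\<close>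
  (\<open>cycles_gap_unique\<close>). Hence the dual solution set \<open>S'\<close> has at most one element, and if there is a
  cycle, then \<open>K\<close> consists of all \<open>(x, x + u)\<close> with \<open>u \<in> B1 x\<close> and \<open>- u \<in> B2 (x + u)\<close>
  (\<open>cycles_eq_if_gap\<close>). All descriptions in terms of \<open>u\<close> and \<open>v = - u\<close> are read off from this form.
  So are closedness and convexity: the value \<open>B\<inverse> u\<close> of the inverse of a maximal monotone operator is
  an intersection of closed half-spaces, and the projections of \<open>K\<close> and its averages are translates
  of one another.

  The resolvents are everywhere defined by the theorem of Minty (\<open>minty_surjectivity\<close>). It
  is proved here by minimizing a quadratic functional over the convex hull of a lifted graph
  (\<open>monotone_set_minty_point\<close>): strong convexity makes minimizing sequences converge in the
  component that matters, and optimality of the limit is the inequality that maximality turns into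
  membership in the graph.
\<close>

section \<open>Maximal monotone operators\<close>

text \<open>
  Maximality says that a pair monotonically related to the whole graph belongs to it, since the graph
  could be enlarged by that pair. In this form maximality is used throughout.
\<close>
lemma maximal_monotone_iff:
  "op_maximal_monotone B \<longleftrightarrow>
    (\<forall>x u. u \<in> B x \<longleftrightarrow> (\<forall>y. \<forall>v\<in>B y. 0 \<le> inner (x - y) (u - v)))"
proof
  assume max: "op_maximal_monotone B"
  then have mono: "op_monotone B"
    by (simp add: op_maximal_monotone_def)
  have "u \<in> B x" if rel: "\<forall>y. \<forall>v\<in>B y. 0 \<le> inner (x - y) (u - v)" for x u
  proof -
    define C where "C = (\<lambda>y. if y = x then insert u (B y) else B y)"
    have gr: "op_graph C = insert (x, u) (op_graph B)"
      by (auto simp: C_def op_graph_def split: if_splits)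
    have "0 \<le> inner (y - x) (v - u)" if "v \<in> B y" for y v
      using rel that by (metis inner_minus_left inner_minus_right minus_diff_eq minus_minus)
    then have "op_monotone C"
      using mono rel by (auto simp: op_monotone_def gr) (auto simp: op_graph_def)
    then have "op_graph C = op_graph B"
      using max gr by (auto simp: op_maximal_monotone_def)
    then show ?thesis
      using gr by (auto simp: op_graph_def)
  qed
  moreover have "0 \<le> inner (x - y) (u - v)" if "u \<in> B x" "v \<in> B y" for x u y v
    using mono that by (simp add: op_monotone_def op_graph_def)
  ultimately show "\<forall>x u. u \<in> B x \<longleftrightarrow> (\<forall>y. \<forall>v\<in>B y. 0 \<le> inner (x - y) (u - v))"
    by blast
next
  assume rel: "\<forall>x u. u \<in> B x \<longleftrightarrow> (\<forall>y. \<forall>v\<in>B y. 0 \<le> inner (x - y) (u - v))"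
  have "op_graph C \<subseteq> op_graph B" if "op_monotone C" "op_graph B \<subseteq> op_graph C" for C
  proof clarify
    fix x u assume xu: "(x, u) \<in> op_graph C"
    have "0 \<le> inner (x - y) (u - v)" if "v \<in> B y" for y v
    proof -
      from that \<open>op_graph B \<subseteq> op_graph C\<close> have "(y, v) \<in> op_graph C"
        by (auto simp: op_graph_def)
      with xu \<open>op_monotone C\<close> show ?thesis by (auto simp: op_monotone_def)
    qed
    with rel have "u \<in> B x" by blast
    then show "(x, u) \<in> op_graph B"
      by (simp add: op_graph_def)
  qed
  moreover have "op_monotone B"
    unfolding op_monotone_def op_graph_def using rel by blast
  ultimately show "op_maximal_monotone B"
    unfolding op_maximal_monotone_def by blast
qed

lemma maximal_monotone_memI:
  assumes "op_maximal_monotone B" and "\<And>y v. v \<in> B y \<Longrightarrow> 0 \<le> inner (x - y) (u - v)"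
  shows "u \<in> B x"
  using assms unfolding maximal_monotone_iff by blast

lemma maximal_monotone_mono:
  assumes "op_maximal_monotone B" and "u \<in> B x" and "v \<in> B y"
  shows "0 \<le> inner (x - y) (u - v)"
  using assms unfolding maximal_monotone_iff by blast

section \<open>Minty's theorem\<close>

text \<open>
  Monotonicity of \<open>G\<close> means that the form \<open>t + t' - inner y v' - inner y' v\<close> is nonnegative at all
  pairs of points \<open>(y, v, t)\<close>, \<open>(y', v', t')\<close> of the lifted graph, where \<open>t = inner y v\<close>. The form is
  affine in each of the two points, so it stays nonnegative on the convex hull; the claim is its value
  on the diagonal.
\<close>
lemma convex_hull_graph_form_nonneg:
  fixes G :: "('a::real_inner \<times> 'a) set"
  assumes mono: "\<And>y v y' v'. (y, v) \<in> G \<Longrightarrow> (y', v') \<in> G \<Longrightarrow> 0 \<le> inner (y - y') (v - v')"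
    and p: "(y, v, t) \<in> convex hull ((\<lambda>(y, v). (y, v, inner y v)) ` G)" (is "_ \<in> convex hull ?P")
  shows "inner y v \<le> t"
proof -
  define H :: "'a \<times> 'a \<times> real \<Rightarrow> ('a \<times> 'a \<times> real) set"
    where "H = (\<lambda>(y', v', t'). {(y, v, t). 0 \<le> t + t' - inner y v' - inner y' v})"
  have sym: "q \<in> H p \<longleftrightarrow> p \<in> H q" for p q
    by (auto simp: H_def inner_commute split: prod.splits)
  have conv: "convex (H q)" for q
  proof (cases q)
    case (fields y' v' t')
    have "H q = {p. inner (v', y', -1) p \<le> t'}"
      by (auto simp: H_def fields inner_commute algebra_simps)
    then show ?thesis by (simp add: convex_halfspace_le)
  qed
  have "?P \<subseteq> H q" if "q \<in> ?P" for q
  proof clarify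
    fix y v assume yv: "(y, v) \<in> G"
    from that obtain y' v' where "(y', v') \<in> G" "q = (y', v', inner y' v')" by auto
    with mono[OF yv this(1)] show "(y, v, inner y v) \<in> H q"
      by (simp add: H_def inner_diff_left inner_diff_right)
  qed
  then have "convex hull ?P \<subseteq> H q" if "q \<in> ?P" for q
    using conv that by (intro hull_minimal)
  then have "?P \<subseteq> H p" if "p \<in> convex hull ?P" for p
    using that sym by blast
  then have "convex hull ?P \<subseteq> H p" if "p \<in> convex hull ?P" for p
    using conv that by (intro hull_minimal)
  with p have "(y, v, t) \<in> H (y, v, t)" by blast
  then show ?thesis by (simp add: H_def)
qed

text \<open>
  With \<open>c = (y - v) / 2\<close>, the inequality \<open>inner (x - y) (x + v) \<le> 0\<close> says that \<open>x\<close> lies in the ball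
  with centre \<open>c\<close> and radius \<open>norm (y + v) / 2\<close>; so the claim is that these balls have a common point.
  The problem is dualized. On the convex hull \<open>K\<close> of the lifted graph the functional
  \<open>d = t + norm c ^ 2\<close> is at least \<open>inner y v + norm c ^ 2 = norm (y + v) ^ 2 / 4 \<ge> 0\<close>, and it is strongly convex
  in \<open>c\<close>. Hence \<open>c\<close> converges along a minimizing sequence, and the first-order optimality condition
  at the limit \<open>x\<close>, tested in the direction of a point of the lifted graph, is the required
  inequality.
\<close>
lemma monotone_set_minty_point:
  fixes G :: "('a::{real_inner, complete_space} \<times> 'a) set"
  assumes mono: "\<And>y v y' v'. (y, v) \<in> G \<Longrightarrow> (y', v') \<in> G \<Longrightarrow> 0 \<le> inner (y - y') (v - v')"
  shows "\<exists>x. \<forall>(y, v)\<in>G. inner (x - y) (x + v) \<le> 0"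
proof (cases "G = {}")
  case False
  define P where "P = (\<lambda>(y, v). (y, v, inner y v)) ` G"
  define K where "K = convex hull P"
  define c :: "'a \<times> 'a \<times> real \<Rightarrow> 'a" where "c = (\<lambda>(y, v, t). (1/2) *\<^sub>R (y - v))"
  define d where "d = (\<lambda>p. snd (snd p) + (norm (c p))\<^sup>2)"
  have PK: "P \<subseteq> K" by (simp add: K_def hull_subset)
  have K_ne: "K \<noteq> {}" using False by (simp add: K_def P_def)
  have d_nonneg: "0 \<le> d p" if "p \<in> K" for p
  proof -
    obtain y v t where p: "p = (y, v, t)" by (cases p)
    have "inner y v \<le> t"
      using that mono unfolding p K_def P_def by (intro convex_hull_graph_form_nonneg[of G]) auto
    moreover have "inner y v + (norm ((1/2) *\<^sub>R (y - v)))\<^sup>2 = (norm ((1/2) *\<^sub>R (y + v)))\<^sup>2"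
      unfolding power2_norm_eq_inner
      by (simp add: inner_add_left inner_add_right inner_diff_left inner_diff_right
          inner_commute field_simps)
    ultimately show ?thesis
      by (simp add: d_def c_def p) (smt (verit) zero_le_power2)
  qed
  \<comment> \<open>The exact strong convexity identity for \<open>d\<close>; the defect involves \<open>c\<close> alone.\<close>
  have d_comb: "d ((1 - s) *\<^sub>R p + s *\<^sub>R q) =
      (1 - s) * d p + s * d q - s * (1 - s) * (norm (c p - c q))\<^sup>2" for s p q
  proof -
    have "c ((1 - s) *\<^sub>R p + s *\<^sub>R q) = (1 - s) *\<^sub>R c p + s *\<^sub>R c q"
      by (simp add: c_def algebra_simps split: prod.splits)
    then show ?thesis
      by (simp add: d_def power2_norm_eq_inner inner_add_left inner_add_right inner_diff_left
          inner_diff_right inner_commute[of "c q" "c p"]) (simp add: algebra_simps power2_eq_square)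
  qed
  define m where "m = Inf (d ` K)"
  have bdd: "bdd_below (d ` K)" using d_nonneg by (intro bdd_belowI[of _ 0]) auto
  have m_le: "m \<le> d p" if "p \<in> K" for p
    unfolding m_def using bdd that by (intro cInf_lower) auto
  have m_nonneg: "0 \<le> m"
    unfolding m_def using K_ne d_nonneg by (intro cInf_greatest) auto
  have key: "m \<le> (1 - s) * d p + s * d q - s * (1 - s) * (norm (c p - c q))\<^sup>2"
    if "p \<in> K" "q \<in> K" "0 \<le> s" "s \<le> 1" for p q s
  proof -
    have "(1 - s) *\<^sub>R p + s *\<^sub>R q \<in> K"
      using that convex_convex_hull[of P] unfolding K_def convex_alt by blast
    from m_le[OF this] show ?thesis by (simp add: d_comb)
  qed
  have "\<exists>p\<in>K. d p < m + inverse (real (Suc n))" for n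
    using K_ne cInf_lessD[of "d ` K" "m + inverse (real (Suc n))"] by (force simp: m_def)
  then obtain p where pK: "\<And>n. p n \<in> K" and p_less: "\<And>n. d (p n) < m + inverse (real (Suc n))"
    by metis
  have d_lim: "(\<lambda>n. d (p n)) \<longlonglongrightarrow> m"
  proof (rule tendsto_sandwich[OF _ _ tendsto_const])
    show "(\<lambda>n. m + inverse (real (Suc n))) \<longlonglongrightarrow> m"
      using tendsto_add[OF tendsto_const LIMSEQ_inverse_real_of_nat, of m] by simp
  qed (use m_le pK p_less in \<open>auto intro!: always_eventually less_imp_le\<close>)
  have "Cauchy (\<lambda>n. c (p n))"
  proof (rule metric_CauchyI)
    fix e :: real assume "0 < e"
    then have "\<forall>\<^sub>F n in sequentially. d (p n) < m + e\<^sup>2 / 4"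
      using order_tendstoD(2)[OF d_lim] by simp
    then obtain N where N: "\<And>n. N \<le> n \<Longrightarrow> d (p n) < m + e\<^sup>2 / 4"
      by (auto simp: eventually_sequentially)
    have "dist (c (p j)) (c (p k)) < e" if "N \<le> j" "N \<le> k" for j k
    proof -
      have "(norm (c (p j) - c (p k)))\<^sup>2 < e\<^sup>2"
        using key[OF pK pK, of "1/2" j k] N[OF that(1)] N[OF that(2)] by (simp add: field_simps)
      then show ?thesis
        using \<open>0 < e\<close> by (simp add: dist_norm power_less_imp_less_base)
    qed
    then show "\<exists>N. \<forall>j\<ge>N. \<forall>k\<ge>N. dist (c (p j)) (c (p k)) < e" by blast
  qed
  then obtain x where x: "(\<lambda>n. c (p n)) \<longlonglongrightarrow> x"
    using Cauchy_convergent convergent_def by blast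
  \<comment> \<open>Optimality at \<open>x\<close>: compare the minimum with the values on the segments from \<open>p n\<close> to \<open>q\<close>, first
    let \<open>n\<close> tend to infinity, and then the step length \<open>s\<close> tend to zero.\<close>
  have ball: "(norm (x - c q))\<^sup>2 \<le> d q" if q: "q \<in> K" for q
  proof -
    have step: "(1 - s) * (norm (x - c q))\<^sup>2 \<le> d q - m" if "0 < s" "s < 1" for s
    proof -
      have "m \<le> (1 - s) * m + s * d q - s * (1 - s) * (norm (x - c q))\<^sup>2"
      proof (rule tendsto_lowerbound)
        show "(\<lambda>n. (1 - s) * d (p n) + s * d q - s * (1 - s) * (norm (c (p n) - c q))\<^sup>2)
            \<longlonglongrightarrow> (1 - s) * m + s * d q - s * (1 - s) * (norm (x - c q))\<^sup>2"
          by (intro tendsto_intros d_lim x)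
      qed (use key[OF pK q] that in \<open>auto intro!: always_eventually\<close>)
      then have "s * ((1 - s) * (norm (x - c q))\<^sup>2) \<le> s * (d q - m)"
        by (simp add: algebra_simps)
      then show ?thesis using \<open>0 < s\<close> by simp
    qed
    have "(1 - 0) * (norm (x - c q))\<^sup>2 \<le> d q - m"
    proof (rule tendsto_upperbound)
      show "((\<lambda>s. (1 - s) * (norm (x - c q))\<^sup>2) \<longlongrightarrow> (1 - 0) * (norm (x - c q))\<^sup>2) (at_right 0)"
        by (intro tendsto_intros)
      show "\<forall>\<^sub>F s in at_right 0. (1 - s) * (norm (x - c q))\<^sup>2 \<le> d q - m"
        using step by (auto simp: eventually_at_right_field intro!: exI[of _ 1])
    qed simp
    with m_nonneg show ?thesis by simp
  qed
  have "inner (x - y) (x + v) \<le> 0" if "(y, v) \<in> G" for y v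
  proof -
    have "(y, v, inner y v) \<in> K" using that PK by (force simp: P_def)
    from ball[OF this] show ?thesis
      by (simp add: d_def c_def power2_norm_eq_inner inner_add_left inner_add_right inner_diff_left
          inner_diff_right inner_commute field_simps)
  qed
  then show ?thesis by blast
qed simp

text \<open>
  For \<open>x = 0\<close> the point found above is monotonically related to the graph; for other \<open>x\<close> the graph is
  translated by \<open>- x\<close> in its second component.
\<close>
theorem minty_surjectivity:
  fixes B :: "'a::{real_inner, complete_space} \<Rightarrow> 'a set"
  assumes "op_maximal_monotone B"
  shows "\<exists>y. x - y \<in> B y"
proof -
  have "\<exists>w. \<forall>(y, v)\<in>{(y, v). v + x \<in> B y}. inner (w - y) (w + v) \<le> 0"
  proof (rule monotone_set_minty_point, clarify)
    fix y v y' v' assume "v + x \<in> B y" "v' + x \<in> B y'"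
    from maximal_monotone_mono[OF assms this] show "0 \<le> inner (y - y') (v - v')" by simp
  qed
  then obtain w where w: "\<And>y v. v + x \<in> B y \<Longrightarrow> inner (w - y) (w + v) \<le> 0" by blast
  have "x - w \<in> B w"
  proof (rule maximal_monotone_memI[OF assms])
    fix y v assume "v \<in> B y"
    with w[of "v - x" y] show "0 \<le> inner (w - y) (x - w - v)"
      by (simp add: inner_diff_right inner_add_right)
  qed
  then show ?thesis by blast
qed

section \<open>Inverses, scalings and resolvents\<close>
lemma closed_convex_op_inverse:
  assumes "op_maximal_monotone B"
  shows "closed (op_inverse B u)" and "convex (op_inverse B u)"
proof -
  have eq: "op_inverse B u = (\<Inter>y. \<Inter>v\<in>B y. {x. inner (u - v) y \<le> inner (u - v) x})"
  proof -
    have halfspace: "inner (u - v) y \<le> inner (u - v) x \<longleftrightarrow> 0 \<le> inner (x - y) (u - v)" for x y v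
      by (auto simp: inner_diff_left inner_diff_right inner_commute)
    have "u \<in> B x \<longleftrightarrow> (\<forall>y. \<forall>v\<in>B y. inner (u - v) y \<le> inner (u - v) x)" for x
      unfolding halfspace using assms unfolding maximal_monotone_iff by blast
    then show ?thesis by (auto simp: op_inverse_def)
  qed
  show "closed (op_inverse B u)"
    unfolding eq by (intro closed_INT ballI closed_Collect_le continuous_intros)
  show "convex (op_inverse B u)"
    unfolding eq by (intro convex_INT convex_halfspace_ge)
qed

lemma mem_op_divide_iff:
  assumes "c \<noteq> 0"
  shows "u \<in> op_divide B c x \<longleftrightarrow> c *\<^sub>R u \<in> B x"
  using assms by (auto simp: op_divide_def intro!: exI[of _ "c *\<^sub>R u"])

lemma maximal_monotone_op_divide:
  assumes "op_maximal_monotone B" and "c > 0"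
  shows "op_maximal_monotone (op_divide B c)"
proof -
  have "c *\<^sub>R u \<in> B x \<longleftrightarrow> (\<forall>y. \<forall>v\<in>op_divide B c y. 0 \<le> inner (x - y) (u - v))" for x u
  proof -
    have "0 \<le> inner (x - y) (u - v /\<^sub>R c) \<longleftrightarrow> 0 \<le> inner (x - y) (c *\<^sub>R u - v)" for y v
    proof -
      have "inner (x - y) (c *\<^sub>R u - v) = c * inner (x - y) (u - v /\<^sub>R c)"
        using \<open>c > 0\<close> by (simp add: inner_diff_right field_simps)
      with \<open>c > 0\<close> show ?thesis by (simp add: zero_le_mult_iff)
    qed
    then have "(\<forall>y. \<forall>v\<in>op_divide B c y. 0 \<le> inner (x - y) (u - v)) \<longleftrightarrow>
        (\<forall>y. \<forall>v\<in>B y. 0 \<le> inner (x - y) (c *\<^sub>R u - v))"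
      by (simp add: op_divide_def setcompr_eq_image)
    then show ?thesis
      using assms(1) unfolding maximal_monotone_iff by blast
  qed
  then show ?thesis
    using \<open>c > 0\<close> by (simp add: maximal_monotone_iff mem_op_divide_iff)
qed

lemma mem_op_resolvent_iff: "y \<in> op_resolvent B x \<longleftrightarrow> x - y \<in> B y"
  by (auto simp: op_resolvent_def op_inverse_def op_add_def op_single_def)
    (metis diff_add_cancel)

lemma resolvent_eqI:
  assumes "x - y \<in> B y" and "\<And>y'. x - y' \<in> B y' \<Longrightarrow> y' = y"
  shows "resolvent B x = y"
  unfolding resolvent_def mem_op_resolvent_iff using assms by (rule the_equality)

lemma monotone_resolvent_unique:
  assumes "op_maximal_monotone B" and "x - y \<in> B y" and "x - y' \<in> B y'"
  shows "y' = y"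
proof -
  have "0 \<le> inner (y - y') ((x - y) - (x - y'))"
    using assms by (rule maximal_monotone_mono)
  then have "inner (y' - y) (y' - y) \<le> 0"
    by (simp add: inner_diff_left inner_diff_right)
  then show ?thesis
    by (metis antisym inner_eq_zero_iff inner_ge_zero right_minus_eq)
qed

text \<open>
  From here on the resolvent, defined by a definite description, is handled through its inclusion;
  the direction from left to right rests on the existence given by Minty's theorem.
\<close>
lemma resolvent_eq_iff:
  fixes B :: "'a::{real_inner, complete_space} \<Rightarrow> 'a set"
  assumes "op_maximal_monotone B"
  shows "resolvent B x = y \<longleftrightarrow> x - y \<in> B y"
  using minty_surjectivity[OF assms, of x] monotone_resolvent_unique[OF assms]
  by (metis resolvent_eqI)

lemma resolvent_op_times:
  fixes B C :: "'a::{real_inner, complete_space} \<Rightarrow> 'a set"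
  assumes "op_maximal_monotone B" and "op_maximal_monotone C"
  shows "resolvent (op_times B C) p = (resolvent B (fst p), resolvent C (snd p))"
proof -
  have "p - q \<in> op_times B C q \<longleftrightarrow> q = (resolvent B (fst p), resolvent C (snd p))" for q
    using resolvent_eq_iff[OF assms(1), of "fst p" "fst q"]
      resolvent_eq_iff[OF assms(2), of "snd p" "snd q"]
    by (auto simp: op_times_def mem_Times_iff prod_eq_iff)
  then show ?thesis by (intro resolvent_eqI) auto
qed

lemma resolvent_op_inverse_minus_Id:
  fixes T :: "'a::real_vector \<Rightarrow> 'a"
  shows "resolvent (op_diff (op_inverse (op_single T)) op_Id) = T"
  by (intro ext resolvent_eqI)
    (auto simp: op_diff_def op_inverse_def op_single_def)

lemma mem_yosida_iff: "u \<in> yosida 1 B x \<longleftrightarrow> u \<in> B (x - u)"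
  by (auto simp: yosida_eq op_inverse_def op_add_def op_scale_def op_single_def)
    (metis add.commute diff_add_cancel)

lemma yosida_eq_resolvent:
  fixes B :: "'a::{real_inner, complete_space} \<Rightarrow> 'a set"
  assumes "op_maximal_monotone B"
  shows "yosida 1 B x = {x - resolvent B x}"
proof -
  have "u \<in> yosida 1 B x \<longleftrightarrow> resolvent B x = x - u" for u
    by (simp add: mem_yosida_iff resolvent_eq_iff[OF assms])
  moreover have "resolvent B x = x - u \<longleftrightarrow> u = x - resolvent B x" for u
    by (auto simp: algebra_simps)
  ultimately show ?thesis by blast
qed

section \<open>Two-operator cycles\<close>

text \<open>
  The inclusions are written without resolvents so that the solution sets below can be compared with
  the cycles by pure algebra.
\<close>
definition cycles :: "('a::minus \<Rightarrow> 'a set) \<Rightarrow> ('a \<Rightarrow> 'a set) \<Rightarrow> ('a \<times> 'a) set"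
  where "cycles B C = {(x, y). y - x \<in> B x \<and> x - y \<in> C y}"

lemma cycles_resolvent:
  fixes B C :: "'a::{real_inner, complete_space} \<Rightarrow> 'a set"
  assumes "op_maximal_monotone B" and "op_maximal_monotone C"
  shows "cycles B C = {(x, y). x = resolvent B y \<and> y = resolvent C x}"
  unfolding cycles_def resolvent_eq_iff[OF assms(1), symmetric]
    resolvent_eq_iff[OF assms(2), symmetric] by auto

lemma zeros_yosida_right:
  fixes B C :: "'a::real_vector \<Rightarrow> 'a set"
  shows "op_inverse (op_add B (yosida 1 C)) 0 = fst ` cycles B C"
proof (intro set_eqI iffI)
  fix x assume "x \<in> op_inverse (op_add B (yosida 1 C)) 0"
  then obtain a b where "a \<in> B x" "b \<in> C (x - b)" "0 = a + b"
    by (auto simp: op_inverse_def op_add_def mem_yosida_iff)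
  then have "(x, x - b) \<in> cycles B C"
    by (simp add: cycles_def eq_neg_iff_add_eq_0[symmetric])
  then show "x \<in> fst ` cycles B C" by force
next
  fix x assume "x \<in> fst ` cycles B C"
  then obtain y where "y - x \<in> B x" "x - y \<in> C y" by (auto simp: cycles_def)
  then show "x \<in> op_inverse (op_add B (yosida 1 C)) 0"
    by (force simp: op_inverse_def op_add_def mem_yosida_iff
        intro: exI[of _ "y - x", OF exI[of _ "x - y"]])
qed

lemma op_add_commute: "op_add B C = op_add C B" for B C :: "'a \<Rightarrow> 'b::ab_semigroup_add set"
  by (auto simp: op_add_def fun_eq_iff add.commute; metis add.commute)

lemma cycles_swap: "cycles C B = prod.swap ` cycles B C"
  by (force simp: cycles_def)

lemma zeros_yosida_left:
  fixes B C :: "'a::real_vector \<Rightarrow> 'a set"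
  shows "op_inverse (op_add (yosida 1 B) C) 0 = snd ` cycles B C"
  unfolding op_add_commute[of "yosida 1 B"] zeros_yosida_right cycles_swap[of C] image_image
  by simp

lemma zeros_Id_minus_swap:
  fixes B C :: "'a::real_vector \<Rightarrow> 'a set"
  shows "op_inverse (op_add (op_diff op_Id (op_single prod.swap)) (op_times B C)) (0, 0)
    = cycles B C"
proof -
  have "(\<exists>a b. 0 = x - y + a \<and> 0 = y - x + b \<and> a \<in> B x \<and> b \<in> C y) \<longleftrightarrow>
      y - x \<in> B x \<and> x - y \<in> C y" for x y
    by (metis add.commute diff_add_cancel minus_diff_eq neg_eq_iff_add_eq_0)
  then show ?thesis
    by (fastforce simp: cycles_def op_inverse_def op_add_def op_diff_def op_single_def op_times_def)
qed


text \<open>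
  A point of the left-hand side is a \<open>w\<close> with \<open>w \<in> (B \<times> C) q\<close> and \<open>w = p - prod.swap p\<close> for some \<open>p = - q\<close>. Thus
  \<open>w = prod.swap q - q\<close>, and the inclusion for \<open>w\<close> says that \<open>q\<close> is a cycle.
\<close>
lemma dual_zeros:
  fixes B C :: "'a::real_vector \<Rightarrow> 'a set"
  shows "op_inverse (op_add (op_inverse (op_diff op_Id (op_single prod.swap)))
      (op_inverse (op_times B C))) (0, 0) = (\<lambda>p. prod.swap p - p) ` cycles B C" (is "?L = ?R")
proof -
  have mem: "w \<in> ?L \<longleftrightarrow>
      (\<exists>p q. (0, 0) = p + q \<and> w = p - prod.swap p \<and> w \<in> op_times B C q)" for w
    by (auto simp: op_inverse_def op_add_def op_diff_def op_single_def)
  have "w \<in> ?L \<longleftrightarrow> (\<exists>q. w = prod.swap q - q \<and> w \<in> op_times B C q)" for w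
  proof
    assume "w \<in> ?L"
    then obtain p q where "(0, 0) = p + q" "w = p - prod.swap p" "w \<in> op_times B C q"
      unfolding mem by blast
    moreover from this(1) have "p = - q"
      by (metis eq_neg_iff_add_eq_0 zero_prod_def)
    ultimately show "\<exists>q. w = prod.swap q - q \<and> w \<in> op_times B C q"
      by (intro exI[of _ q]) (auto simp: prod_eq_iff)
  next
    assume "\<exists>q. w = prod.swap q - q \<and> w \<in> op_times B C q"
    then obtain q where "w = prod.swap q - q" "w \<in> op_times B C q" by blast
    then show "w \<in> ?L"
      unfolding mem by (intro exI[of _ "- q"] exI[of _ q]) (auto simp: prod_eq_iff)
  qed
  moreover have "(\<exists>q. w = prod.swap q - q \<and> w \<in> op_times B C q) \<longleftrightarrow>
      (\<exists>q. q \<in> cycles B C \<and> w = prod.swap q - q)" for w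
    by (intro ex_cong1) (auto simp: cycles_def op_times_def)
  ultimately show ?thesis by blast
qed

lemma mem_op_tilde_iff:
  fixes B :: "'a::group_add \<Rightarrow> 'b::group_add set"
  shows "x \<in> op_tilde B u \<longleftrightarrow> - u \<in> B (- x)"
proof -
  have "x \<in> op_tilde B u \<longleftrightarrow> (\<exists>z. - u \<in> B z \<and> x = - z)"
    by (auto simp: op_tilde_def op_comp_def op_single_def op_inverse_def)
  also have "\<dots> \<longleftrightarrow> - u \<in> B (- x)"
    using minus_minus[of x] by auto
  finally show ?thesis .
qed

lemma op_resolvent_dual_left:
  fixes B C :: "'a::real_vector \<Rightarrow> 'a set"
  shows "op_resolvent (op_add (op_inverse B) (op_tilde C)) 0 = (\<lambda>(x, y). y - x) ` cycles B C"
proof -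
  have "u \<in> op_resolvent (op_add (op_inverse B) (op_tilde C)) 0 \<longleftrightarrow>
      (\<exists>x y. (x, y) \<in> cycles B C \<and> u = y - x)" for u
  proof
    assume "u \<in> op_resolvent (op_add (op_inverse B) (op_tilde C)) 0"
    then obtain x z where "u \<in> B x" "- u \<in> C (- z)" and sum: "- u = x + z"
      by (auto simp: mem_op_resolvent_iff op_add_def op_inverse_def mem_op_tilde_iff)
    moreover from sum have u: "u = - (x + z)"
      by (simp flip: sum)
    moreover have "- z - x = u" "x - - z = - u"
      by (simp_all add: u)
    ultimately have "(x, - z) \<in> cycles B C \<and> u = - z - x"
      by (simp only: cycles_def mem_Collect_eq prod.case)
    then show "\<exists>x y. (x, y) \<in> cycles B C \<and> u = y - x" by blast
  next
    assume "\<exists>x y. (x, y) \<in> cycles B C \<and> u = y - x"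
    then obtain x y where "u = y - x" "y - x \<in> B x" "x - y \<in> C y"
      by (auto simp: cycles_def)
    then show "u \<in> op_resolvent (op_add (op_inverse B) (op_tilde C)) 0"
      unfolding mem_op_resolvent_iff op_add_def op_inverse_def mem_Collect_eq mem_op_tilde_iff
      by (intro exI[of _ x] exI[of _ "- y"]) auto
  qed
  then show ?thesis
    by (simp add: set_eq_iff image_iff Bex_def split_paired_Ex)
qed

lemma op_resolvent_dual_right:
  fixes B C :: "'a::real_vector \<Rightarrow> 'a set"
  shows "op_resolvent (op_add (op_tilde B) (op_inverse C)) 0 = (\<lambda>(x, y). x - y) ` cycles B C"
  unfolding op_add_commute[of "op_tilde B"] op_resolvent_dual_left cycles_swap[of C] image_image
  by (simp add: case_prod_unfold)

text \<open>
  The two monotonicity inequalities add up to minus the squared norm of the difference of the gaps.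
\<close>
lemma cycles_gap_unique:
  assumes "op_maximal_monotone B" and "op_maximal_monotone C"
    and "(x, y) \<in> cycles B C" and "(x', y') \<in> cycles B C"
  shows "y - x = y' - x'"
proof -
  let ?d = "(y - x) - (y' - x')"
  have "0 \<le> inner (x - x') ?d"
    using assms by (intro maximal_monotone_mono[OF assms(1)]) (auto simp: cycles_def)
  moreover have "0 \<le> inner (y - y') ((x - y) - (x' - y'))"
    using assms by (intro maximal_monotone_mono[OF assms(2)]) (auto simp: cycles_def)
  moreover have "inner (x - x') ?d + inner (y - y') ((x - y) - (x' - y')) = - inner ?d ?d"
    by (simp add: inner_diff_left inner_diff_right inner_commute)
  ultimately have "inner ?d ?d \<le> 0" by linarith
  then show ?thesis
    by (metis antisym inner_eq_zero_iff inner_ge_zero right_minus_eq)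
qed

text \<open>
  One known cycle turns the coupled inclusions for \<open>(x, y)\<close> into two separate ones with the constant
  value \<open>u\<close>, together with the linear equation \<open>y - x = u\<close>.
\<close>
lemma cycles_eq_if_gap:
  assumes "op_maximal_monotone B" and "op_maximal_monotone C"
    and "(x0, y0) \<in> cycles B C" and "u = y0 - x0"
  shows "cycles B C = {(x, y). u \<in> B x \<and> - u \<in> C y \<and> y - x = u}"
proof -
  have gap: "y - x = u" if "(x, y) \<in> cycles B C" for x y
    using cycles_gap_unique[OF assms(1,2) that assms(3)] assms(4) by simp
  have "(x, y) \<in> cycles B C \<longleftrightarrow> u \<in> B x \<and> - u \<in> C y \<and> y - x = u" for x y
  proof (cases "y - x = u")
    case True
    moreover from this have "x - y = - u" by (metis minus_diff_eq)
    ultimately show ?thesis by (simp add: cycles_def)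
  qed (use gap in blast)
  then show ?thesis by blast
qed

text \<open>
  All cycles have the form \<open>(x, x + u)\<close> with \<open>x\<close> in a closed convex set \<open>D\<close>, so the combination
  with parameter \<open>s\<close> translates \<open>D\<close> by \<open>s *\<^sub>R u\<close>. The parameters 0 and 1 give the two projections.
\<close>
lemma closed_convex_cycles:
  assumes "op_maximal_monotone B" and "op_maximal_monotone C"
  shows "closed (cycles B C)" and "convex (cycles B C)"
    and "closed ((\<lambda>(x, y). (1 - s) *\<^sub>R x + s *\<^sub>R y) ` cycles B C)"
    and "convex ((\<lambda>(x, y). (1 - s) *\<^sub>R x + s *\<^sub>R y) ` cycles B C)"
proof -
  let ?f = "\<lambda>(x, y). (1 - s) *\<^sub>R x + s *\<^sub>R y"
  consider "cycles B C = {}" | x0 y0 where "(x0, y0) \<in> cycles B C" by fastforce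
  then have "closed (cycles B C) \<and> convex (cycles B C)
      \<and> closed (?f ` cycles B C) \<and> convex (?f ` cycles B C)"
  proof cases
    case 2
    define u where "u = y0 - x0"
    define D where "D = op_inverse B u \<inter> (\<lambda>x. x + u) -` op_inverse C (- u)"
    have eq: "cycles B C = {(x, y). u \<in> B x \<and> - u \<in> C y \<and> y - x = u}"
      using assms 2 u_def by (rule cycles_eq_if_gap)
    have "closed ((\<lambda>x. x + u) -` op_inverse C (- u))"
      using closed_convex_op_inverse(1)[OF assms(2)] by (intro closed_vimage continuous_intros)
    then have "closed D"
      unfolding D_def using closed_convex_op_inverse(1)[OF assms(1)] by (intro closed_Int)
    moreover have "convex D"
    proof -
      have "(\<lambda>x. x + u) -` op_inverse C (- u) = (+) (- u) ` op_inverse C (- u)"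
        by (auto simp: image_iff intro!: bexI[of _ "_ + u"])
      then show ?thesis
        unfolding D_def using closed_convex_op_inverse(2)[OF assms(1)]
          closed_convex_op_inverse(2)[OF assms(2)] by (simp add: convex_Int)
    qed
    moreover have "?f ` cycles B C = (+) (s *\<^sub>R u) ` D"
    proof -
      have "cycles B C = (\<lambda>x. (x, x + u)) ` D"
        unfolding eq D_def by (auto simp: op_inverse_def image_iff algebra_simps)
      then have "?f ` cycles B C = (\<lambda>x. (1 - s) *\<^sub>R x + s *\<^sub>R (x + u)) ` D"
        by (simp add: image_image)
      then show ?thesis by (simp add: algebra_simps)
    qed
    moreover have "cycles B C = op_inverse B u \<times> op_inverse C (- u) \<inter> {p. snd p - fst p = u}"
      unfolding eq by (auto simp: op_inverse_def)
    moreover have "closed {p :: 'a \<times> 'a. snd p - fst p = u}"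
      by (intro closed_Collect_eq continuous_intros)
    moreover have "convex {p :: 'a \<times> 'a. snd p - fst p = u}"
    proof -
      have "linear (\<lambda>p :: 'a \<times> 'a. snd p - fst p)"
        by (auto intro!: linearI simp: algebra_simps)
      from convex_linear_vimage[OF this convex_singleton[of u]]
      show ?thesis by (simp add: vimage_def)
    qed
    ultimately show ?thesis
      using closed_convex_op_inverse[OF assms(1)] closed_convex_op_inverse[OF assms(2)]
      by (simp add: closed_Times convex_Times closed_Int convex_Int closed_translation)
  qed simp
  then show "closed (cycles B C)" "convex (cycles B C)"
      "closed (?f ` cycles B C)" "convex (?f ` cycles B C)" by blast+
qed

section \<open>Averaged resolvents\<close>
lemma Fix_average_resolvents:
  fixes B C :: "'a::{real_inner, complete_space} \<Rightarrow> 'a set"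
  assumes "op_maximal_monotone B" and "op_maximal_monotone C" and "s + t = 1"
  shows "Fix (\<lambda>x. s *\<^sub>R resolvent B x + t *\<^sub>R resolvent C x) =
    op_inverse (op_add (op_scale s (yosida 1 B)) (op_scale t (yosida 1 C))) 0"
proof -
  have "s *\<^sub>R (x - p) + t *\<^sub>R (x - q) = x - (s *\<^sub>R p + t *\<^sub>R q)" for x p q :: 'a
    using assms(3) by (simp add: algebra_simps flip: scaleR_add_left)
  then show ?thesis
    by (auto simp: Fix_def op_inverse_def op_add_def op_scale_def
        yosida_eq_resolvent[OF assms(1)] yosida_eq_resolvent[OF assms(2)])
qed

text \<open>
  The weights are interchanged: \<open>B\<close> has weight \<open>s\<close> in the average and is divided by \<open>t\<close> in the cycle.
  For Yosida values \<open>a\<close> and \<open>b\<close> with \<open>s a + t b = 0\<close>, the gap \<open>a - b\<close> of the points \<open>z - a\<close> and \<open>z - b\<close>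
  satisfies \<open>t (a - b) = t a + s a = a\<close>, and likewise \<open>s (b - a) = b\<close>.
\<close>
lemma zeros_average_yosida:
  fixes B C :: "'a::real_vector \<Rightarrow> 'a set"
  assumes "s > 0" and "t > 0" and "s + t = 1"
  shows "op_inverse (op_add (op_scale s (yosida 1 B)) (op_scale t (yosida 1 C))) 0 =
    (\<lambda>(x, y). s *\<^sub>R x + t *\<^sub>R y) ` cycles (op_divide B t) (op_divide C s)" (is "?L = ?R")
proof (intro set_eqI iffI)
  have s: "s = 1 - t" using assms by simp
  fix z
  {
    assume "z \<in> ?L"
    then obtain a b where ab: "a \<in> B (z - a)" "b \<in> C (z - b)" "s *\<^sub>R a + t *\<^sub>R b = 0"
      by (auto simp: op_inverse_def op_add_def op_scale_def mem_yosida_iff)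
    have "t *\<^sub>R (a - b) = a" "s *\<^sub>R (b - a) = b"
      using ab(3) unfolding s by (simp_all add: algebra_simps)
    moreover have "z = s *\<^sub>R (z - a) + t *\<^sub>R (z - b)"
      using ab(3) unfolding s by (simp add: algebra_simps)
    moreover from calculation(1,2) ab(1,2) assms(1,2)
    have "(z - a, z - b) \<in> cycles (op_divide B t) (op_divide C s)"
      by (simp add: cycles_def mem_op_divide_iff)
    ultimately show "z \<in> ?R" by force
  next
    assume "z \<in> ?R"
    then obtain x y where xy: "t *\<^sub>R (y - x) \<in> B x" "s *\<^sub>R (x - y) \<in> C y"
      and z: "z = s *\<^sub>R x + t *\<^sub>R y"
      using assms(1,2) by (auto simp: cycles_def mem_op_divide_iff)
    have "z - t *\<^sub>R (y - x) = x" "z - s *\<^sub>R (x - y) = y"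
      unfolding z s by (simp_all add: algebra_simps)
    with xy have "t *\<^sub>R (y - x) \<in> yosida 1 B z" "s *\<^sub>R (x - y) \<in> yosida 1 C z"
      by (simp_all add: mem_yosida_iff)
    moreover have "0 = s *\<^sub>R t *\<^sub>R (y - x) + t *\<^sub>R s *\<^sub>R (x - y)"
      by (simp add: algebra_simps)
    ultimately show "z \<in> ?L"
      unfolding op_inverse_def op_add_def op_scale_def by blast
  }
qed

section \<open>Cycles in terms of resolvents and of the gap\<close>
lemma fst_cycles:
  fixes B C :: "'a::{real_inner, complete_space} \<Rightarrow> 'a set"
  assumes "op_maximal_monotone B" and "op_maximal_monotone C"
  shows "fst ` cycles B C = Fix (resolvent B \<circ> resolvent C)"
    and "fst ` cycles B C = resolvent B ` snd ` cycles B C"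
proof -
  have "x \<in> fst ` cycles B C \<longleftrightarrow> resolvent B (resolvent C x) = x" for x
    by (force simp: cycles_resolvent[OF assms])
  then show "fst ` cycles B C = Fix (resolvent B \<circ> resolvent C)"
    unfolding Fix_def comp_def by blast
  have "fst ` cycles B C = (\<lambda>p. resolvent B (snd p)) ` cycles B C"
    by (rule image_cong) (auto simp: cycles_resolvent[OF assms])
  then show "fst ` cycles B C = resolvent B ` snd ` cycles B C"
    by (simp add: image_image)
qed

lemma snd_cycles:
  fixes B C :: "'a::{real_inner, complete_space} \<Rightarrow> 'a set"
  assumes "op_maximal_monotone B" and "op_maximal_monotone C"
  shows "snd ` cycles B C = Fix (resolvent C \<circ> resolvent B)"
    and "snd ` cycles B C = resolvent C ` fst ` cycles B C"
  using fst_cycles[OF assms(2,1)] by (simp_all add: cycles_swap[of C] image_image)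

lemma cycles_Fix_swap:
  fixes B C :: "'a::{real_inner, complete_space} \<Rightarrow> 'a set"
  assumes "op_maximal_monotone B" and "op_maximal_monotone C"
  shows "cycles B C = Fix (resolvent (op_times B C) \<circ> prod.swap)"
  by (auto simp: Fix_def cycles_resolvent[OF assms] resolvent_op_times[OF assms])

lemma cycles_graph:
  fixes B C :: "'a::{real_inner, complete_space} \<Rightarrow> 'a set"
  assumes "op_maximal_monotone B" and "op_maximal_monotone C"
  shows "cycles B C =
    (fst ` cycles B C \<times> snd ` cycles B C) \<inter> op_graph (op_single (resolvent C))"
proof (intro equalityI subsetI)
  fix p assume p: "p \<in> cycles B C"
  then have "snd p = resolvent C (fst p)"
    by (auto simp: cycles_resolvent[OF assms])
  with imageI[OF p, of fst] imageI[OF p, of snd]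
  show "p \<in> (fst ` cycles B C \<times> snd ` cycles B C) \<inter> op_graph (op_single (resolvent C))"
    by (cases p) (simp add: op_graph_def op_single_def)
next
  fix p assume "p \<in> (fst ` cycles B C \<times> snd ` cycles B C) \<inter> op_graph (op_single (resolvent C))"
  then obtain q where q: "q \<in> cycles B C" "fst p = fst q" and "snd p = resolvent C (fst p)"
    by (auto simp: op_graph_def op_single_def)
  then have "p = q"
    by (auto simp: cycles_resolvent[OF assms] prod_eq_iff)
  with q show "p \<in> cycles B C" by simp
qed

lemma fst_cycles_if_gap:
  assumes "cycles B C = {(x, y). u \<in> B x \<and> - u \<in> C y \<and> y - x = u}"
  shows "fst ` cycles B C = op_inverse B u \<inter> op_inverse (yosida 1 C) (- u)"
proof -
  have "x \<in> fst ` cycles B C \<longleftrightarrow> u \<in> B x \<and> - u \<in> C (x + u)" for x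
  proof
    assume "x \<in> fst ` cycles B C"
    then show "u \<in> B x \<and> - u \<in> C (x + u)" by (auto simp: assms)
  next
    assume "u \<in> B x \<and> - u \<in> C (x + u)"
    then have "(x, x + u) \<in> cycles B C" by (simp add: assms)
    then show "x \<in> fst ` cycles B C" by force
  qed
  then show ?thesis
    by (auto simp: op_inverse_def mem_yosida_iff)
qed

lemma snd_cycles_if_gap:
  assumes "cycles B C = {(x, y). u \<in> B x \<and> - u \<in> C y \<and> y - x = u}"
  shows "snd ` cycles B C = op_inverse (yosida 1 B) u \<inter> op_inverse C (- u)"
proof -
  have "y \<in> snd ` cycles B C \<longleftrightarrow> u \<in> B (y - u) \<and> - u \<in> C y" for y
  proof
    assume "y \<in> snd ` cycles B C"
    then show "u \<in> B (y - u) \<and> - u \<in> C y" by (auto simp: assms)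
  next
    assume "u \<in> B (y - u) \<and> - u \<in> C y"
    then have "(y - u, y) \<in> cycles B C" by (simp add: assms)
    then show "y \<in> snd ` cycles B C" by force
  qed
  then show ?thesis
    by (auto simp: op_inverse_def mem_yosida_iff)
qed

text \<open>
  On a cycle of gap \<open>u\<close> the average \<open>z = s x + t y\<close> determines both points, as \<open>x = z - t u\<close> and
  \<open>y = z + s u\<close>.
\<close>
lemma average_cycles_if_gap:
  fixes B C :: "'a::real_vector \<Rightarrow> 'a set"
  assumes "s > 0" and "t > 0" and "s + t = 1"
    and eq: "cycles (op_divide B t) (op_divide C s) =
      {(x, y). u \<in> op_divide B t x \<and> - u \<in> op_divide C s y \<and> y - x = u}"
  shows "(\<lambda>(x, y). s *\<^sub>R x + t *\<^sub>R y) ` cycles (op_divide B t) (op_divide C s) =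
    op_inverse (op_divide (yosida 1 B) t) u \<inter> op_inverse (op_divide (yosida 1 C) s) (- u)"
    (is "?L = ?R")
proof (intro set_eqI)
  have s: "s = 1 - t" using assms by simp
  fix z
  have mem: "z \<in> ?R \<longleftrightarrow> (z - t *\<^sub>R u, z + s *\<^sub>R u) \<in> cycles (op_divide B t) (op_divide C s)"
  proof -
    have "z + s *\<^sub>R u - (z - t *\<^sub>R u) = u"
      by (simp add: s algebra_simps)
    then show ?thesis
      using assms(1,2) by (simp add: eq op_inverse_def mem_op_divide_iff mem_yosida_iff)
  qed
  show "z \<in> ?L \<longleftrightarrow> z \<in> ?R"
  proof
    assume "z \<in> ?L"
    then obtain x y where xy: "(x, y) \<in> cycles (op_divide B t) (op_divide C s)"
      and z: "z = s *\<^sub>R x + t *\<^sub>R y" by auto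
    have y: "y = x + u" using xy by (auto simp: eq)
    have "z - t *\<^sub>R u = x" "z + s *\<^sub>R u = y"
      by (simp_all add: z s y algebra_simps)
    with xy show "z \<in> ?R" unfolding mem by simp
  next
    assume "z \<in> ?R"
    then have "(z - t *\<^sub>R u, z + s *\<^sub>R u) \<in> cycles (op_divide B t) (op_divide C s)"
      unfolding mem .
    moreover have "z = s *\<^sub>R (z - t *\<^sub>R u) + t *\<^sub>R (z + s *\<^sub>R u)"
      by (simp add: s algebra_simps)
    ultimately show "z \<in> ?L" by force
  qed
qed

section \<open>Primal and dual solution sets\<close>
theorem theorem3p3:
  fixes A1 A2 :: "'a::{real_inner, complete_space} \<Rightarrow> 'a set"
    and l1 l2 :: real
    and A B1 B2 :: "'a \<Rightarrow> 'a set"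
    and E F :: "'a set"
    and S S' :: "('a \<times> 'a) set"
  assumes max1: "op_maximal_monotone A1"
    and max2: "op_maximal_monotone A2"
    and l1_pos: "l1 > 0"
    and l2_pos: "l2 > 0"
    and l_sum: "l1 + l2 = 1"
    and A_eq: "A = op_diff
          (op_inverse (op_single (\<lambda>x. l1 *\<^sub>R resolvent A1 x + l2 *\<^sub>R resolvent A2 x))) op_Id"
    and B1_eq: "B1 = op_divide A1 l2"
    and B2_eq: "B2 = op_divide A2 l1"
    and E_eq: "E = op_inverse (op_add B1 (yosida 1 B2)) 0"
    and F_eq: "F = op_inverse (op_add (yosida 1 B1) B2) 0"
    and S_eq: "S = op_inverse
          (op_add (op_diff op_Id (op_single prod.swap)) (op_times B1 B2)) (0, 0)"
    and S'_eq: "S' = op_inverse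
          (op_add (op_inverse (op_diff op_Id (op_single prod.swap)))
                  (op_inverse (op_times B1 B2))) (0, 0)"
  shows
    "(Fix (resolvent A) =
        op_inverse (op_add (op_scale l1 (yosida 1 A1)) (op_scale l2 (yosida 1 A2))) 0
      \<and> Fix (resolvent A) =
        {z. z = resolvent A z \<and> resolvent A z = l1 *\<^sub>R resolvent A1 z + l2 *\<^sub>R resolvent A2 z})
    \<and> (E = Fix (resolvent B1 \<circ> resolvent B2) \<and> E = resolvent B1 ` F)
    \<and> (F = Fix (resolvent B2 \<circ> resolvent B1) \<and> F = resolvent B2 ` E)
    \<and> (S = {(x, y). x = resolvent B1 y \<and> y = resolvent B2 x}
      \<and> S = Fix (resolvent (op_times B1 B2) \<circ> prod.swap)
      \<and> S = (E \<times> F) \<inter> op_graph (op_single (resolvent B2)))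
    \<and> ((S' = {} \<or> (\<exists>p. S' = {p}))
      \<and> S' = {(u, v). u \<in> op_resolvent (op_add (op_inverse B1) (op_tilde B2)) 0
                    \<and> v \<in> op_resolvent (op_add (op_tilde B1) (op_inverse B2)) 0}
      \<and> (\<forall>(u, v)\<in>S'. u = - v)
      \<and> (S' = {} \<longleftrightarrow> op_resolvent (op_add (op_inverse B1) (op_tilde B2)) 0 = {})
      \<and> (S' = {} \<longleftrightarrow> op_resolvent (op_add (op_tilde B1) (op_inverse B2)) 0 = {}))
    \<and> (S' = (\<lambda>p. prod.swap p - p) ` S
      \<and> (\<forall>(u, v)\<in>S'. \<forall>(x, y)\<in>S. y - x = u))
    \<and> (\<forall>u v. S' = {(u, v)} \<longrightarrow>
       (E = op_inverse B1 u \<inter> op_inverse (yosida 1 B2) v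
        \<and> F = op_inverse (yosida 1 B1) u \<inter> op_inverse B2 v)
       \<and> (bij_betw (resolvent B2) E F \<and> (\<forall>x\<in>E. resolvent B2 x = x + u)
        \<and> bij_betw (resolvent B1) F E \<and> (\<forall>y\<in>F. resolvent B1 y = y + v)
        \<and> (\<forall>x\<in>E. resolvent B1 (resolvent B2 x) = x)
        \<and> (\<forall>y\<in>F. resolvent B2 (resolvent B1 y) = y))
       \<and> (S = (E \<times> F) \<inter> op_inverse (op_diff (op_single prod.swap) op_Id) (u, v)
        \<and> S = op_inverse (op_times B1 B2) (u, v)
              \<inter> op_inverse (op_diff (op_single prod.swap) op_Id) (u, v))
       \<and> Fix (resolvent A) =
         op_inverse (op_divide (yosida 1 A1) l2) u \<inter> op_inverse (op_divide (yosida 1 A2) l1) v)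
    \<and> (closed (Fix (resolvent A)) \<and> convex (Fix (resolvent A))
      \<and> closed E \<and> convex E \<and> closed F \<and> convex F \<and> closed S \<and> convex S)"
proof -
  have B1: "op_maximal_monotone B1" and B2: "op_maximal_monotone B2"
    using assms by (simp_all add: maximal_monotone_op_divide)
  define K where "K = cycles B1 B2"
  have E: "E = fst ` K" and F: "F = snd ` K" and S: "S = K"
    and S': "S' = (\<lambda>p. prod.swap p - p) ` K"
    unfolding K_def E_eq F_eq S_eq S'_eq
    by (rule zeros_yosida_right zeros_yosida_left zeros_Id_minus_swap dual_zeros)+
  have JA: "resolvent A = (\<lambda>x. l1 *\<^sub>R resolvent A1 x + l2 *\<^sub>R resolvent A2 x)"
    unfolding A_eq by (rule resolvent_op_inverse_minus_Id)
  have Fix_zeros: "Fix (resolvent A) =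
      op_inverse (op_add (op_scale l1 (yosida 1 A1)) (op_scale l2 (yosida 1 A2))) 0"
    unfolding JA using max1 max2 l_sum by (rule Fix_average_resolvents)
  have Fix_K: "Fix (resolvent A) = (\<lambda>(x, y). l1 *\<^sub>R x + l2 *\<^sub>R y) ` K"
    unfolding Fix_zeros K_def B1_eq B2_eq using l1_pos l2_pos l_sum by (rule zeros_average_yosida)
  have gap: "y - x = y' - x'" if "(x, y) \<in> K" "(x', y') \<in> K" for x y x' y'
    using that unfolding K_def by (rule cycles_gap_unique[OF B1 B2])
  have E_Fix: "E = Fix (resolvent B1 \<circ> resolvent B2)" "E = resolvent B1 ` F"
    unfolding E F K_def by (fact fst_cycles[OF B1 B2])+
  have F_Fix: "F = Fix (resolvent B2 \<circ> resolvent B1)" "F = resolvent B2 ` E"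
    unfolding E F K_def by (fact snd_cycles[OF B1 B2])+

  have i: "Fix (resolvent A) =
      {z. z = resolvent A z \<and> resolvent A z = l1 *\<^sub>R resolvent A1 z + l2 *\<^sub>R resolvent A2 z}"
    by (auto simp: Fix_def JA)

  have iv: "S = {(x, y). x = resolvent B1 y \<and> y = resolvent B2 x}"
    "S = Fix (resolvent (op_times B1 B2) \<circ> prod.swap)"
    "S = (E \<times> F) \<inter> op_graph (op_single (resolvent B2))"
    unfolding S E F K_def
    by (fact cycles_resolvent[OF B1 B2] cycles_Fix_swap[OF B1 B2] cycles_graph[OF B1 B2])+

  have S'_pairs: "S' = (\<lambda>(x, y). (y - x, x - y)) ` K"
    unfolding S' by (rule image_cong) auto
  have S'_const: "S' = {(y - x, x - y)}" if "(x, y) \<in> K" for x y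
  proof -
    have const: "(y' - x', x' - y') = (y - x, x - y)" if "(x', y') \<in> K" for x' y'
      using gap[OF that \<open>(x, y) \<in> K\<close>] by (metis minus_diff_eq)
    have "S' \<subseteq> {(y - x, x - y)}"
      unfolding S'_pairs
    proof (rule image_subsetI)
      fix p assume "p \<in> K"
      then show "(case p of (x, y) \<Rightarrow> (y - x, x - y)) \<in> {(y - x, x - y)}"
        using const[of "fst p" "snd p"] by (simp add: case_prod_unfold)
    qed
    moreover have "(y - x, x - y) \<in> S'"
      unfolding S'_pairs using that by (intro image_eqI[of _ _ "(x, y)"]) auto
    ultimately show ?thesis by blast
  qed
  have v1: "S' = {} \<or> (\<exists>p. S' = {p})"
  proof (cases "K = {}")
    case False
    then obtain x y where "(x, y) \<in> K" by fastforce
    from S'_const[OF this] show ?thesis by blast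
  qed (simp add: S')
  have dual_resolvents: "op_resolvent (op_add (op_inverse B1) (op_tilde B2)) 0 = fst ` S'"
    "op_resolvent (op_add (op_tilde B1) (op_inverse B2)) 0 = snd ` S'"
    unfolding op_resolvent_dual_left op_resolvent_dual_right S'_pairs image_image K_def
    by (simp_all add: case_prod_unfold)
  have v2: "S' = {(u, v). u \<in> op_resolvent (op_add (op_inverse B1) (op_tilde B2)) 0
      \<and> v \<in> op_resolvent (op_add (op_tilde B1) (op_inverse B2)) 0}"
    unfolding dual_resolvents using v1 by auto
  have v3: "\<forall>(u, v)\<in>S'. u = - v"
    by (auto simp: S'_pairs)
  have v4: "S' = {} \<longleftrightarrow> op_resolvent (op_add (op_inverse B1) (op_tilde B2)) 0 = {}"
    "S' = {} \<longleftrightarrow> op_resolvent (op_add (op_tilde B1) (op_inverse B2)) 0 = {}"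
    unfolding dual_resolvents by simp_all

  have vi: "\<forall>(u, v)\<in>S'. \<forall>(x, y)\<in>S. y - x = u"
    using gap by (auto simp: S'_pairs S)

  have gapped: "(E = op_inverse B1 u \<inter> op_inverse (yosida 1 B2) v
        \<and> F = op_inverse (yosida 1 B1) u \<inter> op_inverse B2 v)
       \<and> (bij_betw (resolvent B2) E F \<and> (\<forall>x\<in>E. resolvent B2 x = x + u)
        \<and> bij_betw (resolvent B1) F E \<and> (\<forall>y\<in>F. resolvent B1 y = y + v)
        \<and> (\<forall>x\<in>E. resolvent B1 (resolvent B2 x) = x)
        \<and> (\<forall>y\<in>F. resolvent B2 (resolvent B1 y) = y))
       \<and> (S = (E \<times> F) \<inter> op_inverse (op_diff (op_single prod.swap) op_Id) (u, v)
        \<and> S = op_inverse (op_times B1 B2) (u, v)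
              \<inter> op_inverse (op_diff (op_single prod.swap) op_Id) (u, v))
       \<and> Fix (resolvent A) =
         op_inverse (op_divide (yosida 1 A1) l2) u \<inter> op_inverse (op_divide (yosida 1 A2) l1) v"
    if uv: "S' = {(u, v)}" for u v
  proof -
    from uv S' obtain x0 y0 where K0: "(x0, y0) \<in> K" by fastforce
    from S'_const[OF K0] uv have u: "u = y0 - x0" and v: "v = - u" by auto
    have K_eq: "K = {(x, y). u \<in> B1 x \<and> - u \<in> B2 y \<and> y - x = u}"
      using K0 u unfolding K_def by (rule cycles_eq_if_gap[OF B1 B2])
    have vii: "E = op_inverse B1 u \<inter> op_inverse (yosida 1 B2) v"
      "F = op_inverse (yosida 1 B1) u \<inter> op_inverse B2 v"
      unfolding E F K_def v
      by (rule fst_cycles_if_gap[OF K_eq[unfolded K_def]] snd_cycles_if_gap[OF K_eq[unfolded K_def]])+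
    have K_step: "y = x + u" "x = y + v" if "(x, y) \<in> K" for x y
      using that by (auto simp: K_eq v)
    have K_J: "x = resolvent B1 y" "y = resolvent B2 x" if "(x, y) \<in> K" for x y
      using that unfolding K_def cycles_resolvent[OF B1 B2] by blast+
    have EJ: "resolvent B2 x = x + u" "resolvent B1 (resolvent B2 x) = x" if "x \<in> E" for x
    proof -
      obtain y where "(x, y) \<in> K" using \<open>x \<in> E\<close> unfolding E by force
      then show "resolvent B2 x = x + u" "resolvent B1 (resolvent B2 x) = x"
        using K_step(1) K_J by metis+
    qed
    have FJ: "resolvent B1 y = y + v" "resolvent B2 (resolvent B1 y) = y" if "y \<in> F" for y
    proof -
      obtain x where "(x, y) \<in> K" using \<open>y \<in> F\<close> unfolding F by force
      then show "resolvent B1 y = y + v" "resolvent B2 (resolvent B1 y) = y"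
        using K_step(2) K_J by metis+
    qed
    have bij: "bij_betw (resolvent B2) E F" "bij_betw (resolvent B1) F E"
      using EJ(2) FJ(2) E_Fix(2) F_Fix(2)
      by (metis bij_betw_byWitness order_refl)+
    have shift: "op_inverse (op_diff (op_single prod.swap) op_Id) (u, v) = {(x, y). y - x = u}"
      by (auto simp: op_inverse_def op_diff_def op_single_def v)
    have ix: "S = (E \<times> F) \<inter> op_inverse (op_diff (op_single prod.swap) op_Id) (u, v)"
      "S = op_inverse (op_times B1 B2) (u, v)
              \<inter> op_inverse (op_diff (op_single prod.swap) op_Id) (u, v)"
    proof -
      show K_inv: "S = op_inverse (op_times B1 B2) (u, v)
              \<inter> op_inverse (op_diff (op_single prod.swap) op_Id) (u, v)"
        unfolding shift S K_eq by (auto simp: op_inverse_def op_times_def v)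
      have "E \<times> F \<subseteq> op_inverse (op_times B1 B2) (u, v)"
        unfolding E F K_eq by (auto simp: op_inverse_def op_times_def v)
      moreover have "K \<subseteq> E \<times> F" unfolding E F by force
      ultimately show "S = (E \<times> F) \<inter> op_inverse (op_diff (op_single prod.swap) op_Id) (u, v)"
        using K_inv S by blast
    qed
    have x: "Fix (resolvent A) =
        op_inverse (op_divide (yosida 1 A1) l2) u \<inter> op_inverse (op_divide (yosida 1 A2) l1) v"
      unfolding Fix_K K_def v B1_eq B2_eq using l1_pos l2_pos l_sum
      by (rule average_cycles_if_gap) (rule K_eq[unfolded K_def B1_eq B2_eq])
    show ?thesis
      using vii bij EJ FJ ix x by blast
  qed

  have xi: "closed (Fix (resolvent A))" "convex (Fix (resolvent A))" "closed E" "convex E"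
    "closed F" "convex F" "closed S" "convex S"
  proof -
    have l1: "l1 = 1 - l2" using l_sum by simp
    have E_comb: "E = (\<lambda>(x, y). (1 - 0) *\<^sub>R x + 0 *\<^sub>R y) ` K"
      and F_comb: "F = (\<lambda>(x, y). (1 - 1) *\<^sub>R x + 1 *\<^sub>R y) ` K"
      unfolding E F by (auto intro!: image_cong)
    show "closed (Fix (resolvent A))" "convex (Fix (resolvent A))" "closed E" "convex E"
      "closed F" "convex F" "closed S" "convex S"
      unfolding Fix_K l1 E_comb F_comb S K_def
      by (fact closed_convex_cycles[OF B1 B2])+
  qed

  show ?thesis
    using Fix_zeros i E_Fix F_Fix iv v1 v2 v3 v4 S' vi gapped xi unfolding S by blast
qed

end
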